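(* Let $q$ be a prime power, let $m,n\ge 1$, and let $\mathcal{C}$ be a nondegenerate $[n,k,d]_{q^m/q}$ rank-metric intersecting code. Then $k\le d\le m$.
   Context: Support and rank: fix an $\mathbb{F}_q$-basis $\Gamma$ of $\mathbb{F}_{q^m}$. For $x=(x_1,\dots,x_n)\in\mathbb{F}_{q^m}^n$ let $\mathrm{Mat}_\Gamma(x)\in\mathbb{F}_q^{m\times n}$ be the matrix whose $j$-th column is the coordinate vector of $x_j$ in the basis $\Gamma$. The support $\sigma(x)\subseteq\mathbb{F}_q^n$ is the $\mathbb{F}_q$-row space of $\mathrm{Mat}_\Gamma(x)$, and $\mathrm{rk}(x)=\dim_{\mathbb{F}_q}\sigma(x)$; both are independent of $\Gamma$. An $[n,k,d]_{q^m/q}$ code is an $\mathbb{F}_{q^m}$-linear subspace $\mathcal{C}$ of $\mathbb{F}_{q^m}^n$ with $k=\dim_{\mathbb{F}_{q^m}}\mathcal{C}\ge 1$ and minimum distance $d=\min_{c\in\mathcal{C}\setminus\{0\}}\mathrm{rk}(c)$. The code is nondegenerate if $\sum_{c\in\mathcal{C}}\sigma(c)=\mathbb{F}_q^n$. It is rank-metric intersecting if $\sigma(c)\cap\sigma(c')\ne\{0\}$ for all $c,c'\in\mathcal{C}\setminus\{0\}$. *)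

theory Defs
  imports "HOL-Analysis.Analysis" "HOL-Library.Set_Algebras"
begin

(* 'f plays the role of F_q and 'l that of F_(q^m): a field extension is a unital ring
   homomorphism between (finite) field types, which is automatically injective.  Vectors of
   length n are vectors indexed by a finite type 'n; the extension degree m is the
   cardinality of the type 'm indexing a basis. *)

locale field_embedding =
  fixes emb :: "'f::field \<Rightarrow> 'l::field"
  assumes emb_one: "emb 1 = 1"
    and emb_add: "emb (a + b) = emb a + emb b"
    and emb_mult: "emb (a * b) = emb a * emb b"

definition ext_scale :: "('f::field \<Rightarrow> 'l::field) \<Rightarrow> 'f \<Rightarrow> 'l \<Rightarrow> 'l"
  where "ext_scale emb a x = emb a * x"

sublocale field_embedding \<subseteq> ext: vector_space "ext_scale emb"
  by unfold_locales (simp_all add: ext_scale_def emb_one emb_add emb_mult algebra_simps)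

definition ext_basis ::
    "('f::field \<Rightarrow> 'l::field) \<Rightarrow> ('m::finite \<Rightarrow> 'l) \<Rightarrow> bool"
  where "ext_basis emb \<Gamma> \<longleftrightarrow>
    inj \<Gamma> \<and> \<not> module.dependent (ext_scale emb) (range \<Gamma>) \<and>
    module.span (ext_scale emb) (range \<Gamma>) = UNIV"

definition Mat ::
    "('f::field \<Rightarrow> 'l::field) \<Rightarrow> ('m::finite \<Rightarrow> 'l) \<Rightarrow> 'l^'n::finite \<Rightarrow> 'f^'n^'m"
  where "Mat emb \<Gamma> x =
    (\<chi> i j. module.representation (ext_scale emb) (range \<Gamma>) (x $ j) (\<Gamma> i))"

definition supp ::
    "('f::field \<Rightarrow> 'l::field) \<Rightarrow> ('m::finite \<Rightarrow> 'l) \<Rightarrow> 'l^'n::finite \<Rightarrow> ('f^'n) set"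
  where "supp emb \<Gamma> x = vec.span (rows (Mat emb \<Gamma> x))"

definition rk ::
    "('f::field \<Rightarrow> 'l::field) \<Rightarrow> ('m::finite \<Rightarrow> 'l) \<Rightarrow> 'l^'n::finite \<Rightarrow> nat"
  where "rk emb \<Gamma> x = vec.dim (supp emb \<Gamma> x)"

(* Over finite fields C is finite, and k >= 1 makes C - {0} nonempty, so Min is a genuine
   minimum. *)
definition rank_metric_code ::
    "('f::{field,finite} \<Rightarrow> 'l::{field,finite}) \<Rightarrow> ('m::finite \<Rightarrow> 'l) \<Rightarrow>
     ('l^'n::finite) set \<Rightarrow> nat \<Rightarrow> nat \<Rightarrow> bool"
  where "rank_metric_code emb \<Gamma> C k d \<longleftrightarrow>
    vec.subspace C \<and> vec.dim C = k \<and> 1 \<le> k \<and> d = Min (rk emb \<Gamma> ` (C - {0}))"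

(* The sum of sets is the Minkowski sum of Set_Algebras, i.e. the sum of subspaces. *)
definition nondegenerate ::
    "('f::{field,finite} \<Rightarrow> 'l::{field,finite}) \<Rightarrow> ('m::finite \<Rightarrow> 'l) \<Rightarrow>
     ('l^'n::finite) set \<Rightarrow> bool"
  where "nondegenerate emb \<Gamma> C \<longleftrightarrow> (\<Sum>c\<in>C. supp emb \<Gamma> c) = UNIV"

definition rank_intersecting ::
    "('f::{field,finite} \<Rightarrow> 'l::{field,finite}) \<Rightarrow> ('m::finite \<Rightarrow> 'l) \<Rightarrow>
     ('l^'n::finite) set \<Rightarrow> bool"
  where "rank_intersecting emb \<Gamma> C \<longleftrightarrow>
    (\<forall>c\<in>C - {0}. \<forall>c'\<in>C - {0}. supp emb \<Gamma> c \<inter> supp emb \<Gamma> c' \<noteq> {0})"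

end

theory Submission
  imports Defs
begin

text \<open>Let \<open>S\<close> be the support of a nonzero codeword and extend scalars in an
  \<open>\<F>\<^sub>q\<close>-linear projection of \<open>\<F>\<^sub>q\<^sup>n\<close> onto \<open>S\<close>. A codeword killed by the extended
  map has its support inside the kernel of the projection, which meets \<open>S\<close> only in \<open>0\<close>; by the
  intersecting property it vanishes. So the code embeds into the image, whose dimension is
  \<open>dim S\<close>, and \<open>k \<le> dim S\<close>. The other bound holds because a support is spanned by \<open>m\<close> rows.\<close>

definition ext_vec :: "('f \<Rightarrow> 'l) \<Rightarrow> 'f^'n \<Rightarrow> 'l^'n"
  where "ext_vec emb v = (\<chi> i. emb (v $ i))"

lemma column_map_matrix: "column j (map_matrix emb A) = ext_vec emb (column j A)"
  by (simp add: column_def ext_vec_def)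

context field_embedding
begin

lemma emb_zero: "emb 0 = 0"
  using emb_add[of 0 0] by (metis add.right_neutral add_left_cancel)

text \<open>Coordinatewise \<open>emb\<close> is semilinear, so it turns a linear combination over
  \<open>'f\<close> into one over \<open>'l\<close> with embedded coefficients.\<close>

lemma ext_vec_span:
  fixes v :: "'f^'n"
  assumes "v \<in> vec.span B"
  shows "ext_vec emb v \<in> vec.span (ext_vec emb ` B)"
  using assms
proof (induction rule: vec.span_induct_alt)
  case base
  have "ext_vec emb (0 :: 'f^'n) = 0"
    by (simp add: ext_vec_def emb_zero vec_eq_iff)
  then show ?case by (simp add: vec.span_zero)
next
  case (step c x y)
  have "ext_vec emb (c *s x + y) = emb c *s ext_vec emb x + ext_vec emb y"
    by (simp add: ext_vec_def emb_add emb_mult vec_eq_iff)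
  with step show ?case
    by (simp add: vec.span_add vec.span_scale vec.span_base)
qed

text \<open>The columns of the extended matrix span its range over \<open>'l\<close>. Each is an
  embedded vector of \<open>S\<close>, so the embedded basis of \<open>S\<close> already spans the
  range.\<close>

lemma dim_range_map_matrix_le:
  fixes A :: "'f^'n^'k"
  assumes "range ((*v) A) \<subseteq> S"
  shows "vec.dim (range ((*v) (map_matrix emb A))) \<le> vec.dim S"
proof -
  obtain B where B: "B \<subseteq> S" "vec.independent B" "S \<subseteq> vec.span B" "card B = vec.dim S"
    using vec.basis_exists by blast
  have fin: "finite B"
    using B(2) by (rule vec.finiteI_independent)
  \<comment> \<open>A column is the image of a standard basis vector.\<close>
  have col: "column j A \<in> S" for j
    using subsetD[OF assms rangeI, of "axis j 1"]
    by (simp add: column_def matrix_vector_mult_def axis_def if_distrib cong: if_cong)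
  have "map_matrix emb A *v x \<in> vec.span (ext_vec emb ` B)" for x
    unfolding matrix_mult_sum column_map_matrix
    by (intro vec.span_sum vec.span_scale ext_vec_span subsetD[OF B(3)] col)
  then have "vec.dim (range ((*v) (map_matrix emb A))) \<le> card (ext_vec emb ` B)"
    using fin by (intro vec.dim_le_card) auto
  also have "\<dots> \<le> vec.dim S"
    using fin B(4) card_image_le by metis
  finally show ?thesis .
qed

text \<open>Row \<open>i\<close> lists the coordinates of the entries of \<open>x\<close> at the
  basis element \<open>\<Gamma> i\<close>. Taking this coordinate is linear over \<open>'f\<close>,
  so it commutes with combinations whose coefficients come from \<open>A\<close>.\<close>

lemma row_Mat_map_matrix_mult:
  assumes "ext_basis emb \<Gamma>"
  shows "row i (Mat emb \<Gamma> (map_matrix emb A *v x)) = A *v row i (Mat emb \<Gamma> x)"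
proof -
  let ?rep = "ext.representation (range \<Gamma>)"
  have ind: "ext.independent (range \<Gamma>)" and spn: "ext.span (range \<Gamma>) = UNIV"
    using assms by (auto simp: ext_basis_def)
  have "?rep (\<Sum>j\<in>UNIV. ext_scale emb (A $ l $ j) (x $ j)) (\<Gamma> i) =
      (\<Sum>j\<in>UNIV. A $ l $ j * ?rep (x $ j) (\<Gamma> i))" for l
    using ind spn by (simp add: ext.representation_sum ext.representation_scale)
  then show ?thesis
    by (simp add: row_def Mat_def matrix_vector_mult_def ext_scale_def vec_eq_iff)
qed

lemma supp_subset_kernel:
  assumes "ext_basis emb \<Gamma>" and "map_matrix emb A *v x = 0"
  shows "supp emb \<Gamma> x \<subseteq> {v. A *v v = 0}"
proof -
  have "A *v row i (Mat emb \<Gamma> x) = 0" for i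
    unfolding row_Mat_map_matrix_mult[OF assms(1), symmetric] assms(2)
    by (simp add: row_def Mat_def ext.representation_zero vec_eq_iff)
  then have "rows (Mat emb \<Gamma> x) \<subseteq> {v. A *v v = 0}"
    by (auto simp: rows_def)
  moreover have "vec.subspace {v. A *v v = 0}"
    by (auto simp: vec.subspace_def matrix_vector_right_distrib vector_scalar_commute)
  ultimately show ?thesis
    unfolding supp_def by (rule vec.span_minimal)
qed

lemma dim_code_le_rk:
  assumes "ext_basis emb \<Gamma>" and "vec.subspace C" and "c \<in> C - {0}"
    and meet: "\<And>c'. c' \<in> C - {0} \<Longrightarrow> supp emb \<Gamma> c \<inter> supp emb \<Gamma> c' \<noteq> {0}"
  shows "vec.dim C \<le> rk emb \<Gamma> c"
proof -
  let ?S = "supp emb \<Gamma> c"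
  have "vec.subspace ?S"
    by (simp add: supp_def)
  \<comment> \<open>A left inverse of the identity on \<open>?S\<close> with values in
    \<open>?S\<close> is a linear projection onto \<open>?S\<close>.\<close>
  then obtain g where g: "range g \<subseteq> ?S" "Vector_Spaces.linear (*s) (*s) g" "\<And>v. v \<in> ?S \<Longrightarrow> g v = v"
    using vec.linear_exists_left_inverse_on[OF vec.linear_id, of ?S] by auto
  define A where "A = matrix g"
  have A: "A *v v = g v" for v
    using g(2) unfolding A_def by (rule matrix_works)
  let ?h = "(*v) (map_matrix emb A)"
  have "x = 0" if "x \<in> C" "?h x = 0" for x
  proof (rule ccontr)
    assume "x \<noteq> 0"
    with meet that have "?S \<inter> supp emb \<Gamma> x \<noteq> {0}" by blast
    \<comment> \<open>A common vector is fixed by \<open>g\<close> as an element of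
      \<open>?S\<close>, yet sent to 0 as an element of the support of \<open>x\<close>.\<close>
    moreover have "?S \<inter> supp emb \<Gamma> x \<subseteq> {0}"
      using supp_subset_kernel[OF assms(1) that(2)] g(3) by (auto simp: A)
    moreover have "0 \<in> ?S \<inter> supp emb \<Gamma> x"
      by (simp add: supp_def vec.span_zero)
    ultimately show False by blast
  qed
  then have "inj_on ?h C"
    using assms(2) vec.linear_inj_on_iff_eq_0[OF matrix_vector_mul_linear_gen] by blast
  then have "vec.dim C = vec.dim (?h ` C)"
    using assms(2) by (metis vec.dim_image_eq matrix_vector_mul_linear_gen vec.span_eq_iff)
  also have "\<dots> \<le> vec.dim (range ?h)"
    by (intro vec.dim_subset) blast
  also have "\<dots> \<le> rk emb \<Gamma> c"
    unfolding rk_def using g(1) by (intro dim_range_map_matrix_le) (auto simp: A)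
  finally show ?thesis .
qed

end

lemma rk_le_card: "rk emb (\<Gamma> :: 'm::finite \<Rightarrow> _) x \<le> CARD('m)"
proof -
  let ?R = "rows (Mat emb \<Gamma> x)"
  have R: "?R = range (\<lambda>i. row i (Mat emb \<Gamma> x))"
    by (auto simp: rows_def)
  have "rk emb \<Gamma> x \<le> card ?R"
    unfolding rk_def supp_def vec.dim_span R by (intro vec.dim_le_card') simp
  also have "\<dots> \<le> CARD('m)"
    unfolding R by (rule card_image_le) simp
  finally show ?thesis .
qed

theorem theorem4p2:
  fixes emb :: "'f::{field,finite} \<Rightarrow> 'l::{field,finite}"
    and \<Gamma> :: "'m::finite \<Rightarrow> 'l"
    and C :: "('l^'n::finite) set"
    and k d :: nat
  assumes "field_embedding emb"
    and "ext_basis emb \<Gamma>"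
    and "rank_metric_code emb \<Gamma> C k d"
    and "nondegenerate emb \<Gamma> C"
    and "rank_intersecting emb \<Gamma> C"
  shows "k \<le> d \<and> d \<le> CARD('m)"
proof -
  interpret field_embedding emb by (fact assms(1))
  have C: "vec.subspace C" "vec.dim C = k" "1 \<le> k" "d = Min (rk emb \<Gamma> ` (C - {0}))"
    using assms(3) by (auto simp: rank_metric_code_def)
  \<comment> \<open>Positive dimension yields a nonzero codeword, so the minimum runs over a
    nonempty set and is attained.\<close>
  have "\<not> C \<subseteq> {0}"
    using C(2,3) vec.dim_subset[of C "{0}"] by auto
  then have "d \<in> rk emb \<Gamma> ` (C - {0})"
    unfolding C(4) by (intro Min_in) auto
  then obtain c where c: "c \<in> C - {0}" "d = rk emb \<Gamma> c" by blast
  have "k \<le> d"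
    using dim_code_le_rk[OF assms(2) C(1) c(1)] assms(5) c C(2) by (auto simp: rank_intersecting_def)
  with rk_le_card c(2) show ?thesis by simp
qed

end
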